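(* If $k\geq 3$ and $Q_k$ is the $k$-dimensional hypercube, then $k+1 \leq B(Q_k) \leq \left\lfloor \frac{3k}{2} \right\rfloor$.
   Context: $Q_k$ has vertex set $\{0,1\}^k$, two vertices adjacent iff they differ in exactly one coordinate. Bodyguards and Presidents is a two-player game on a finite simple graph $G$. One player controls a set of tokens called bodyguards, the other a single token called the president. First all bodyguards are placed on vertices (several may share a vertex), then the president is placed. The players then alternate turns, bodyguards first; on a player's turn, each token they control either moves to an adjacent vertex or stays put. The president is surrounded if every vertex of the open neighbourhood of the president's vertex is occupied by a bodyguard. The bodyguards win if there is a finite time after which, at the end of every bodyguard turn, the president is surrounded; otherwise the president wins. The bodyguard number $B(G)$ is the minimum number of bodyguards that guarantees a win for the bodyguards on $G$. *)

theory Defs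
  imports "HOL-Library.FuncSet"
begin

locale finite_simple_graph =
  fixes V :: "'a set" and adj :: "'a \<Rightarrow> 'a \<Rightarrow> bool"
  assumes finite_verts: "finite V"
    and adj_in_verts: "adj u v \<Longrightarrow> u \<in> V \<and> v \<in> V"
    and adj_sym: "adj u v \<Longrightarrow> adj v u"
    and adj_irrefl: "\<not> adj u u"

definition token_move :: "('a \<Rightarrow> 'a \<Rightarrow> bool) \<Rightarrow> 'a \<Rightarrow> 'a \<Rightarrow> bool" where
  "token_move adj u v \<longleftrightarrow> v = u \<or> adj u v"

text \<open>
  A play is recorded by two sequences: \<open>b 0\<close> and \<open>p 0\<close> are the initial placements of the
  bodyguards and of the president, \<open>b (Suc t)\<close> and \<open>p (Suc t)\<close> are their positions after their
  respective turns in round \<open>t\<close>. In round \<open>t\<close> the bodyguards move first, so at the end of their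
  turn the position is \<open>b (Suc t)\<close>, \<open>p t\<close>. A placement of \<open>n\<close> bodyguards is a list of length
  \<open>n\<close>, the \<open>i\<close>-th entry being the vertex of the \<open>i\<close>-th bodyguard.
\<close>

definition legal_bodyguards ::
  "'a set \<Rightarrow> ('a \<Rightarrow> 'a \<Rightarrow> bool) \<Rightarrow> nat \<Rightarrow> (nat \<Rightarrow> 'a list) \<Rightarrow> bool" where
  "legal_bodyguards V adj n b \<longleftrightarrow>
     length (b 0) = n \<and> set (b 0) \<subseteq> V \<and> (\<forall>t. list_all2 (token_move adj) (b t) (b (Suc t)))"

definition legal_president :: "'a set \<Rightarrow> ('a \<Rightarrow> 'a \<Rightarrow> bool) \<Rightarrow> (nat \<Rightarrow> 'a) \<Rightarrow> bool" where
  "legal_president V adj p \<longleftrightarrow> p 0 \<in> V \<and> (\<forall>t. token_move adj (p t) (p (Suc t)))"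

definition surrounded :: "('a \<Rightarrow> 'a \<Rightarrow> bool) \<Rightarrow> 'a list \<Rightarrow> 'a \<Rightarrow> bool" where
  "surrounded adj bs x \<longleftrightarrow> (\<forall>v. adj x v \<longrightarrow> v \<in> set bs)"

definition bodyguards_win_play ::
  "('a \<Rightarrow> 'a \<Rightarrow> bool) \<Rightarrow> (nat \<Rightarrow> 'a list) \<Rightarrow> (nat \<Rightarrow> 'a) \<Rightarrow> bool" where
  "bodyguards_win_play adj b p \<longleftrightarrow> (\<exists>T. \<forall>t\<ge>T. surrounded adj (b (Suc t)) (p t))"

text \<open>
  A bodyguard strategy consists of an initial placement \<open>b0\<close> and a map \<open>\<sigma>\<close> that sends the history
  of all positions so far (oldest first) to the next placement of the bodyguards.
\<close>

definition follows_strategy ::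
  "'a list \<Rightarrow> (('a list \<times> 'a) list \<Rightarrow> 'a list) \<Rightarrow> (nat \<Rightarrow> 'a list) \<Rightarrow> (nat \<Rightarrow> 'a) \<Rightarrow> bool" where
  "follows_strategy b0 \<sigma> b p \<longleftrightarrow>
     b 0 = b0 \<and> (\<forall>t. b (Suc t) = \<sigma> (map (\<lambda>s. (b s, p s)) [0..<Suc t]))"

definition bodyguards_win :: "'a set \<Rightarrow> ('a \<Rightarrow> 'a \<Rightarrow> bool) \<Rightarrow> nat \<Rightarrow> bool" where
  "bodyguards_win V adj n \<longleftrightarrow>
     (\<exists>b0 \<sigma>. \<forall>b p. follows_strategy b0 \<sigma> b p \<and> legal_president V adj p \<longrightarrow>
        legal_bodyguards V adj n b \<and> bodyguards_win_play adj b p)"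

definition bodyguard_number :: "'a set \<Rightarrow> ('a \<Rightarrow> 'a \<Rightarrow> bool) \<Rightarrow> nat" where
  "bodyguard_number V adj = (LEAST n. bodyguards_win V adj n)"

text \<open>One stationary bodyguard per vertex wins, so on a finite simple graph the minimum is attained.\<close>

lemma (in finite_simple_graph) bodyguards_win_card: "bodyguards_win V adj (card V)"
proof -
  obtain b0 where b0: "set b0 = V" "distinct b0"
    using finite_distinct_list[OF finite_verts] by blast
  then have len: "length b0 = card V"
    using distinct_card by fastforce
  show ?thesis
    unfolding bodyguards_win_def
  proof (intro exI allI impI)
    fix b p
    assume "follows_strategy b0 (\<lambda>_. b0) b p \<and> legal_president V adj p"
    then have f: "b 0 = b0" "\<And>t. b (Suc t) = b0"
      by (simp_all add: follows_strategy_def)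
    have "b t = b0" for t
      using f by (cases t) auto
    then show "legal_bodyguards V adj (card V) b \<and> bodyguards_win_play adj b p"
      using b0 len adj_in_verts
      by (auto simp: legal_bodyguards_def bodyguards_win_play_def surrounded_def
          token_move_def intro: list.rel_refl)
  qed
qed

lemma (in finite_simple_graph) bodyguards_win_bodyguard_number:
  "bodyguards_win V adj (bodyguard_number V adj)"
  unfolding bodyguard_number_def by (rule LeastI) (rule bodyguards_win_card)

definition cube_verts :: "nat \<Rightarrow> (nat \<Rightarrow> nat) set" where
  "cube_verts k = {..<k} \<rightarrow>\<^sub>E {0, 1}"

definition cube_adj :: "nat \<Rightarrow> (nat \<Rightarrow> nat) \<Rightarrow> (nat \<Rightarrow> nat) \<Rightarrow> bool" where
  "cube_adj k x y \<longleftrightarrow>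
     x \<in> cube_verts k \<and> y \<in> cube_verts k \<and> card {i \<in> {..<k}. x i \<noteq> y i} = 1"

lemma finite_simple_graph_cube: "finite_simple_graph (cube_verts k) (cube_adj k)"
proof
  show "finite (cube_verts k)"
    unfolding cube_verts_def by (intro finite_PiE) auto
next
  fix u v
  assume a: "cube_adj k u v"
  then show "u \<in> cube_verts k \<and> v \<in> cube_verts k"
    by (simp add: cube_adj_def)
  have "{i \<in> {..<k}. u i \<noteq> v i} = {i \<in> {..<k}. v i \<noteq> u i}"
    by auto
  with a show "cube_adj k v u"
    by (simp add: cube_adj_def)
qed (simp add: cube_adj_def)

end

theory Submission
  imports Defs
begin

text \<open>
  Lower bound: as \<open>k \<ge> 3\<close>, the president can keep one chosen bodyguard at distance at least two
  forever, and at most \<open>k - 1\<close> other bodyguards cannot occupy \<open>k\<close> neighbours.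

  Upper bound: record each bodyguard by the set of coordinates in which it differs from the
  president. A move of the president flips at most one coordinate \<open>j\<close> in all these sets at once,
  so every bodyguard can undo it and keep its set; it suffices to improve one or two sets per
  round. As long as fewer than \<open>k\<close> sets are empty, more than \<open>k / 2\<close> sets \<open>D\<close> are nonempty, and
  some bodyguard can lower, lexicographically, the sum of all \<open>\<lceil>|D| / 2\<rceil>\<close>, then the truth value of
  ``all \<open>|D|\<close> are even'', then the number of coordinates in no set: if the president stays, remove
  an element from a set, of odd size if possible; if \<open>j\<close> lies in some \<open>D\<close>, remove \<open>j\<close> and one further
  element from it; if \<open>j\<close> lies in no set but some \<open>a\<close> lies in two, replace \<open>a\<close> by \<open>j\<close> in one of them;
  otherwise the sets are disjoint and miss \<open>j\<close>, so by counting two of them are singletons, and one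
  of these is enlarged by \<open>j\<close>. Once \<open>k\<close> bodyguards stand on the president, they spread
  over the \<open>k\<close> directions, at least one per round whatever the president does.
\<close>

section \<open>Strategies on arbitrary graphs\<close>

text \<open>Both position sequences depend on the whole past, so the recursion runs on the history
  list; each position is read off its last entry.\<close>

lemma play_against_strategy_exists:
  fixes b0 :: "'a list" and p0 :: 'a
  obtains b p where "follows_strategy b0 \<sigma> b p" "p 0 = p0"
    "\<And>t. p (Suc t) = g (b (Suc t)) (p t)"
proof -
  define h where "h = rec_nat [(b0, p0)]
    (\<lambda>t xs. xs @ [(\<sigma> xs, g (\<sigma> xs) (snd (last xs)))])"
  have h0: "h 0 = [(b0, p0)]"
    by (simp add: h_def)
  have hS: "h (Suc t) = h t @ [(\<sigma> (h t), g (\<sigma> (h t)) (snd (last (h t))))]" for t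
    by (simp add: h_def)
  define b where "b t = fst (last (h t))" for t
  define p where "p t = snd (last (h t))" for t
  have hist: "h t = map (\<lambda>s. (b s, p s)) [0..<Suc t]" for t
  proof (induction t)
    case 0
    show ?case by (simp add: h0 b_def p_def)
  next
    case (Suc t)
    have "h (Suc t) = h t @ [(b (Suc t), p (Suc t))]"
      by (simp add: hS b_def p_def)
    then show ?case using Suc by simp
  qed
  have bS: "b (Suc t) = \<sigma> (h t)" for t
    by (simp add: b_def hS)
  show thesis
  proof
    show "follows_strategy b0 \<sigma> b p"
      unfolding follows_strategy_def
    proof (intro conjI allI)
      show "b 0 = b0" by (simp add: b_def h0)
      show "b (Suc t) = \<sigma> (map (\<lambda>s. (b s, p s)) [0..<Suc t])" for t
        by (simp only: bS hist)
    qed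
    show "p 0 = p0" by (simp add: p_def h0)
    show "p (Suc t) = g (b (Suc t)) (p t)" for t
      by (simp add: bS p_def hS)
  qed
qed

lemma (in finite_simple_graph) token_move_in_verts:
  "token_move adj u v \<Longrightarrow> u \<in> V \<Longrightarrow> v \<in> V"
  using adj_in_verts by (auto simp: token_move_def)

lemma (in finite_simple_graph) token_moves_in_verts:
  "list_all2 (token_move adj) bs cs \<Longrightarrow> set bs \<subseteq> V \<Longrightarrow> set cs \<subseteq> V"
  by (induction rule: list_all2_induct) (auto dest: token_move_in_verts)

lemma (in finite_simple_graph) legal_bodyguards_invariant:
  assumes "legal_bodyguards V adj n b"
  shows "length (b t) = n \<and> set (b t) \<subseteq> V"
proof (induction t)
  case 0
  then show ?case using assms by (simp add: legal_bodyguards_def)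
next
  case (Suc t)
  have "list_all2 (token_move adj) (b t) (b (Suc t))"
    using assms by (simp add: legal_bodyguards_def)
  then show ?case using Suc token_moves_in_verts list_all2_lengthD by metis
qed

text \<open>The rank is evaluated after a bodyguard turn, so it is compared across the president's move
  from \<open>x\<close> to \<open>y\<close> followed by the reply of the bodyguards.\<close>

lemma (in finite_simple_graph) bodyguards_win_by_rank:
  fixes rank :: "'a list \<Rightarrow> 'a \<Rightarrow> nat"
  assumes b0: "length b0 = n" "set b0 \<subseteq> V"
    and step: "\<And>bs x y. length bs = n \<Longrightarrow> set bs \<subseteq> V \<Longrightarrow> x \<in> V \<Longrightarrow> token_move adj x y \<Longrightarrow>
      \<exists>cs. list_all2 (token_move adj) bs cs \<and> (rank cs y < rank bs x \<or> rank cs y = 0)"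
    and goal: "\<And>bs x. length bs = n \<Longrightarrow> set bs \<subseteq> V \<Longrightarrow> x \<in> V \<Longrightarrow> rank bs x = 0 \<Longrightarrow>
      surrounded adj bs x"
  shows "bodyguards_win V adj n"
proof -
  define reply where "reply bs x y = (SOME cs. list_all2 (token_move adj) bs cs \<and>
    (rank cs y < rank bs x \<or> rank cs y = 0))" for bs x y
  have reply: "list_all2 (token_move adj) bs (reply bs x y) \<and>
      (rank (reply bs x y) y < rank bs x \<or> rank (reply bs x y) y = 0)"
    if "length bs = n" "set bs \<subseteq> V" "x \<in> V" "token_move adj x y" for bs x y
    unfolding reply_def using step[OF that] by (rule someI_ex)
  \<comment> \<open>The president's last move runs from the last but one entry to the last. In the
    first round the truncated index is 0, as if the president had just stayed put.\<close>
  define \<sigma> where "\<sigma> xs = reply (fst (last xs)) (snd (xs ! (length xs - 2))) (snd (last xs))"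
    for xs :: "('a list \<times> 'a) list"
  show ?thesis
    unfolding bodyguards_win_def
  proof (intro exI allI impI)
    fix b p
    assume "follows_strategy b0 \<sigma> b p \<and> legal_president V adj p"
    then have b_0: "b 0 = b0"
      and b_Suc: "\<And>t. b (Suc t) = \<sigma> (map (\<lambda>s. (b s, p s)) [0..<Suc t])"
      and p0: "p 0 \<in> V" and pmove: "\<And>t. token_move adj (p t) (p (Suc t))"
      by (auto simp: follows_strategy_def legal_president_def)
    have pV: "p t \<in> V" for t
      by (induction t) (auto intro: p0 token_move_in_verts[OF pmove])
    define q where "q t = p (t - 1)" for t
    have qV: "q t \<in> V" for t
      by (simp add: q_def pV)
    have qmove: "token_move adj (q t) (p t)" for t
      using pmove[of "t - 1"] by (cases t) (auto simp: q_def token_move_def)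
    have qS: "q (Suc t) = p t" for t
      by (simp add: q_def)
    have bS: "b (Suc t) = reply (b t) (q t) (p t)" for t
    proof -
      have "map (\<lambda>s. (b s, p s)) [0..<Suc t] ! (Suc t - 2) = (b (t - 1), p (t - 1))"
        by (subst nth_map) (auto simp: nth_append simp del: upt_Suc)
      then show ?thesis
        by (simp add: b_Suc \<sigma>_def q_def)
    qed
    have inv: "length (b t) = n \<and> set (b t) \<subseteq> V" for t
    proof (induction t)
      case 0
      then show ?case using b0 b_0 by simp
    next
      case (Suc t)
      then have "list_all2 (token_move adj) (b t) (b (Suc t))"
        using reply qV qmove by (simp add: bS)
      then show ?case using Suc token_moves_in_verts list_all2_lengthD by metis
    qed
    have moves: "list_all2 (token_move adj) (b t) (b (Suc t))"
      and desc: "rank (b (Suc t)) (q (Suc t)) < rank (b t) (q t) \<or> rank (b (Suc t)) (q (Suc t)) = 0"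
      for t
      using reply[of "b t" "q t" "p t"] inv qV qmove by (auto simp: bS qS)
    \<comment> \<open>Once the rank is 0 it cannot fall further, so \<open>desc\<close> keeps it at
      0.\<close>
    have bound: "rank (b t) (q t) \<le> rank (b 0) (q 0) - t \<or> rank (b t) (q t) = 0" for t
    proof (induction t)
      case (Suc t)
      then show ?case using desc[of t] by linarith
    qed simp
    have "surrounded adj (b (Suc t)) (p t)" if "t \<ge> rank (b 0) (q 0)" for t
    proof -
      have "rank (b (Suc t)) (p t) = 0"
        using bound[of "Suc t"] that by (auto simp: qS)
      then show ?thesis using goal inv pV by blast
    qed
    then have "bodyguards_win_play adj b p"
      by (auto simp: bodyguards_win_play_def)
    moreover have "legal_bodyguards V adj n b"
      using b0 b_0 moves by (simp add: legal_bodyguards_def)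
    ultimately show "legal_bodyguards V adj n b \<and> bodyguards_win_play adj b p"
      by simp
  qed
qed

section \<open>Hypercubes\<close>

definition cube_diff :: "nat \<Rightarrow> (nat \<Rightarrow> nat) \<Rightarrow> (nat \<Rightarrow> nat) \<Rightarrow> nat set" where
  "cube_diff k x y = {i. i < k \<and> x i \<noteq> y i}"

text \<open>\<open>restrict\<close> keeps the result extensional, as membership in
  \<open>cube_verts k\<close> demands.\<close>

definition cube_flip :: "nat \<Rightarrow> nat set \<Rightarrow> (nat \<Rightarrow> nat) \<Rightarrow> nat \<Rightarrow> nat" where
  "cube_flip k S x = restrict (\<lambda>i. if i \<in> S then 1 - x i else x i) {..<k}"

lemma cube_diff_subset: "cube_diff k x y \<subseteq> {..<k}"
  by (auto simp: cube_diff_def)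

lemma finite_cube_diff [simp]: "finite (cube_diff k x y)"
  by (simp add: cube_diff_def)

lemma cube_diff_commute: "cube_diff k x y = cube_diff k y x"
  by (auto simp: cube_diff_def)

lemma cube_verts_coord: "x \<in> cube_verts k \<Longrightarrow> i < k \<Longrightarrow> x i = 0 \<or> x i = 1"
  unfolding cube_verts_def using PiE_mem by fastforce

lemma cube_flip_in_verts [simp]:
  assumes x: "x \<in> cube_verts k"
  shows "cube_flip k S x \<in> cube_verts k"
proof -
  have "(if i \<in> S then 1 - x i else x i) \<in> {0, 1}" if "i < k" for i
    using cube_verts_coord[OF x that] by (elim disjE) simp_all
  then show ?thesis
    unfolding cube_flip_def cube_verts_def by (simp only: restrict_PiE_iff lessThan_iff ball_simps) blast
qed

text \<open>Lets any wanted difference set be turned back into an actual vertex.\<close>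

lemma cube_diff_flip: "x \<in> cube_verts k \<Longrightarrow> S \<subseteq> {..<k} \<Longrightarrow> cube_diff k (cube_flip k S x) x = S"
proof (rule set_eqI)
  fix i
  assume "x \<in> cube_verts k" "S \<subseteq> {..<k}"
  then show "i \<in> cube_diff k (cube_flip k S x) x \<longleftrightarrow> i \<in> S"
    using cube_verts_coord[of x k i] by (cases "i < k") (auto simp: cube_diff_def cube_flip_def)
qed

text \<open>With only two values per coordinate, differences add modulo 2. Hence a president's move
  adds one and the same set to all difference sets.\<close>

lemma cube_diff_triangle:
  assumes "x \<in> cube_verts k" "y \<in> cube_verts k" "z \<in> cube_verts k"
  shows "cube_diff k x z = sym_diff (cube_diff k x y) (cube_diff k y z)"
proof (rule set_eqI)
  fix i
  show "i \<in> cube_diff k x z \<longleftrightarrow> i \<in> sym_diff (cube_diff k x y) (cube_diff k y z)"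
    using assms[THEN cube_verts_coord, of i] by (cases "i < k") (auto simp: cube_diff_def)
qed

lemma cube_diff_empty_iff:
  assumes "x \<in> cube_verts k" "y \<in> cube_verts k"
  shows "cube_diff k x y = {} \<longleftrightarrow> x = y"
  using assms PiE_ext[of x "{..<k}" "\<lambda>_. {0, 1}" y] unfolding cube_diff_def cube_verts_def by blast

lemma cube_adj_iff:
  "cube_adj k x y \<longleftrightarrow> x \<in> cube_verts k \<and> y \<in> cube_verts k \<and> card (cube_diff k x y) = 1"
  by (simp add: cube_adj_def cube_diff_def)

lemma cube_token_move_iff:
  assumes "x \<in> cube_verts k" "y \<in> cube_verts k"
  shows "token_move (cube_adj k) x y \<longleftrightarrow> card (cube_diff k x y) \<le> 1"
proof -
  have "card (cube_diff k x y) = 0 \<longleftrightarrow> x = y"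
    using cube_diff_empty_iff[OF assms] by simp
  then show ?thesis
    using assms by (auto simp: token_move_def cube_adj_iff le_Suc_eq)
qed

lemma cube_neighbours_card:
  assumes "x \<in> cube_verts k"
  shows "card {y. cube_adj k x y} = k"
proof -
  have "{y. cube_adj k x y} = (\<lambda>l. cube_flip k {l} x) ` {..<k}"
  proof (intro equalityI subsetI)
    fix y assume "y \<in> {y. cube_adj k x y}"
    then have y: "y \<in> cube_verts k" "card (cube_diff k y x) = 1"
      by (auto simp: cube_adj_iff cube_diff_commute)
    then obtain l where l: "cube_diff k y x = {l}"
      by (auto simp: card_1_singleton_iff)
    have "l < k" using l cube_diff_subset[of k y x] by auto
    have "cube_diff k y (cube_flip k {l} x) = {}"
      using cube_diff_triangle[OF y(1) assms, of "cube_flip k {l} x"] l assms \<open>l < k\<close>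
      by (simp add: cube_diff_commute[of k x] cube_diff_flip)
    then have "y = cube_flip k {l} x"
      using y(1) assms cube_diff_empty_iff by simp
    then show "y \<in> (\<lambda>l. cube_flip k {l} x) ` {..<k}"
      using \<open>l < k\<close> by blast
  next
    fix y assume "y \<in> (\<lambda>l. cube_flip k {l} x) ` {..<k}"
    then show "y \<in> {y. cube_adj k x y}"
      using assms by (auto simp: cube_adj_iff cube_diff_commute[of k x] cube_diff_flip)
  qed
  moreover have "inj_on (\<lambda>l. cube_flip k {l} x) {..<k}"
  proof (rule inj_onI)
    fix l m assume lm: "l \<in> {..<k}" "m \<in> {..<k}" and eq: "cube_flip k {l} x = cube_flip k {m} x"
    have "{l} = cube_diff k (cube_flip k {l} x) x"
      using assms lm(1) by (simp add: cube_diff_flip)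
    also have "\<dots> = {m}"
      unfolding eq using assms lm(2) by (simp add: cube_diff_flip)
    finally show "l = m" by simp
  qed
  ultimately show ?thesis by (simp add: card_image)
qed

section \<open>Lower bound\<close>

lemma cube_diff_card_move:
  assumes "x \<in> cube_verts k" "y \<in> cube_verts k" "z \<in> cube_verts k" "token_move (cube_adj k) x y"
  shows "card (cube_diff k x z) \<le> card (cube_diff k y z) + 1"
proof -
  have "cube_diff k x z \<subseteq> cube_diff k x y \<union> cube_diff k y z"
    using cube_diff_triangle[OF assms(1-3)] by auto
  then have "card (cube_diff k x z) \<le> card (cube_diff k x y \<union> cube_diff k y z)"
    by (intro card_mono) auto
  then show ?thesis
    using assms cube_token_move_iff card_Un_le[of "cube_diff k x y" "cube_diff k y z"] by fastforce
qed

text \<open>Flipping a coordinate in which \<open>u\<close> and \<open>x\<close> agree gains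
  distance. If there is none, \<open>x\<close> is antipodal to \<open>u\<close>, already at distance
  \<open>k\<close>.\<close>

lemma cube_escape_move:
  assumes k: "k \<ge> 3" and V: "u \<in> cube_verts k" "x \<in> cube_verts k"
    and far: "card (cube_diff k u x) \<ge> 2"
  shows "\<exists>y. token_move (cube_adj k) x y \<and> card (cube_diff k u y) \<ge> 3"
proof (cases "cube_diff k u x = {..<k}")
  case True
  then show ?thesis using k by (intro exI[of _ x]) (auto simp: token_move_def)
next
  case False
  then obtain j where j: "j < k" "j \<notin> cube_diff k u x"
    using cube_diff_subset[of k u x] by auto
  let ?y = "cube_flip k {j} x"
  have xy: "cube_diff k x ?y = {j}"
    using V j by (subst cube_diff_commute) (simp add: cube_diff_flip)
  have "cube_diff k u ?y = insert j (cube_diff k u x)"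
    using cube_diff_triangle[of u k x ?y] V j xy by auto
  then have "card (cube_diff k u ?y) \<ge> 3"
    using j far by simp
  moreover have "token_move (cube_adj k) x ?y"
    using V xy by (simp add: cube_token_move_iff)
  ultimately show ?thesis by blast
qed

text \<open>Pigeonhole: the head occupies no neighbour of \<open>x\<close>, and at most
  \<open>k - 1\<close> other bodyguards face \<open>k\<close> neighbours.\<close>

lemma not_surrounded_if_far:
  assumes x: "x \<in> cube_verts k" and bs: "length bs \<le> k" "bs \<noteq> []"
    and far: "card (cube_diff k (hd bs) x) \<ge> 2"
  shows "\<not> surrounded (cube_adj k) bs x"
proof
  assume "surrounded (cube_adj k) bs x"
  moreover have "\<not> cube_adj k x (hd bs)"
    using far by (auto simp: cube_adj_iff cube_diff_commute)
  ultimately have "{y. cube_adj k x y} \<subseteq> set (tl bs)"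
    using bs(2) by (cases bs) (auto simp: surrounded_def)
  then have "card {y. cube_adj k x y} \<le> length (tl bs)"
    using card_mono[OF finite_set] card_length le_trans by blast
  then show False
    using bs x by (cases bs) (auto simp: cube_neighbours_card)
qed

lemma cube_not_bodyguards_win:
  assumes k: "k \<ge> 3" and n: "n \<le> k"
  shows "\<not> bodyguards_win (cube_verts k) (cube_adj k) n"
proof
  interpret finite_simple_graph "cube_verts k" "cube_adj k"
    by (rule finite_simple_graph_cube)
  assume "bodyguards_win (cube_verts k) (cube_adj k) n"
  then obtain b0 \<sigma> where win: "\<And>b p. follows_strategy b0 \<sigma> b p \<Longrightarrow>
      legal_president (cube_verts k) (cube_adj k) p \<Longrightarrow>
      legal_bodyguards (cube_verts k) (cube_adj k) n b \<and> bodyguards_win_play (cube_adj k) b p"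
    unfolding bodyguards_win_def by blast
  \<comment> \<open>Guarding the distance condition makes a good reply exist for all arguments, even
    for \<open>hd []\<close>. So the president's play is legal before \<open>win\<close> can yield
    that the bodyguards' play is.\<close>
  define good where "good bs x y \<longleftrightarrow> token_move (cube_adj k) x y \<and>
      (hd bs \<in> cube_verts k \<and> x \<in> cube_verts k \<and> card (cube_diff k (hd bs) x) \<ge> 2 \<longrightarrow>
        card (cube_diff k (hd bs) y) \<ge> 3)" for bs x y
  define g where "g bs x = (SOME y. good bs x y)" for bs x
  have "\<exists>y. good bs x y" for bs x
    using cube_escape_move[OF k, of "hd bs" x]
    by (cases "hd bs \<in> cube_verts k \<and> x \<in> cube_verts k \<and> card (cube_diff k (hd bs) x) \<ge> 2")
      (auto simp: good_def token_move_def)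
  then have g: "good bs x (g bs x)" for bs x
    unfolding g_def by (rule someI_ex)
  obtain v where v: "v \<in> cube_verts k"
    unfolding cube_verts_def by (metis PiE_eq_empty_iff ex_in_conv insert_not_empty)
  \<comment> \<open>The antipode of the head bodyguard, at distance \<open>k\<close>;
    \<open>v\<close> is a default in case \<open>hd b0\<close> is no vertex.\<close>
  define p0 where "p0 = (if hd b0 \<in> cube_verts k then cube_flip k {..<k} (hd b0) else v)"
  obtain b p where f: "follows_strategy b0 \<sigma> b p" and p0: "p 0 = p0"
    and pS: "\<And>t. p (Suc t) = g (b (Suc t)) (p t)"
    using play_against_strategy_exists[of b0 \<sigma> p0 g] by blast
  have leg_p: "legal_president (cube_verts k) (cube_adj k) p"
    using g v by (auto simp: legal_president_def p0 p0_def pS good_def)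
  have pV: "p t \<in> cube_verts k" for t
  proof (induction t)
    case 0
    then show ?case using leg_p by (simp add: legal_president_def)
  next
    case (Suc t)
    then show ?case
      using leg_p token_move_in_verts by (auto simp: legal_president_def)
  qed
  have leg_b: "legal_bodyguards (cube_verts k) (cube_adj k) n b"
    and "bodyguards_win_play (cube_adj k) b p"
    using win[OF f leg_p] by auto
  then obtain T where T: "surrounded (cube_adj k) (b (Suc T)) (p T)"
    by (auto simp: bodyguards_win_play_def)
  note inv = legal_bodyguards_invariant[OF leg_b]
  show False
  proof (cases "n = 0")
    case True
    then have "{y. cube_adj k (p T) y} = {}"
      using T inv[of "Suc T"] by (auto simp: surrounded_def)
    then show False
      using cube_neighbours_card[OF pV, of T] k by simp
  next
    case False
    then have ne: "b t \<noteq> []" for t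
      using inv[of t] by auto
    have hV: "hd (b t) \<in> cube_verts k" for t
      using inv[of t] hd_in_set[OF ne] by blast
    have hm: "token_move (cube_adj k) (hd (b t)) (hd (b (Suc t)))" for t
    proof -
      have "list_all2 (token_move (cube_adj k)) (b t) (b (Suc t))"
        using leg_b by (simp add: legal_bodyguards_def)
      then show ?thesis
        using ne[of t] ne[of "Suc t"] by (cases "b t"; cases "b (Suc t)") auto
    qed
    have near: "card (cube_diff k (hd (b (Suc t))) (p t)) \<ge> 2"
      if "card (cube_diff k (hd (b t)) (p t)) \<ge> 3" for t
      using cube_diff_card_move[OF hV hV pV hm, of t t] that by linarith
    \<comment> \<open>A bodyguard turn lowers the distance to 2 at worst, and the president's reply
      restores 3.\<close>
    have far: "card (cube_diff k (hd (b t)) (p t)) \<ge> 3" for t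
    proof (induction t)
      case 0
      have "b 0 = b0" using f by (simp add: follows_strategy_def)
      then have "p 0 = cube_flip k {..<k} (hd (b 0))"
        using hV[of 0] by (simp add: p0 p0_def)
      then show ?case
        using hV[of 0] k by (subst cube_diff_commute) (simp add: cube_diff_flip)
    next
      case (Suc t)
      then show ?case
        using near[of t] g[of "b (Suc t)" "p t"] hV pV by (simp add: good_def pS)
    qed
    show False
      using not_surrounded_if_far[OF pV _ ne near[OF far]] inv n T by metis
  qed
qed

section \<open>Upper bound\<close>

text \<open>A difference set \<open>{l}\<close> means a bodyguard on the president's neighbour in
  direction \<open>l\<close>; several there count once.\<close>

definition occupied_dirs :: "nat \<Rightarrow> nat \<Rightarrow> (nat \<Rightarrow> nat set) \<Rightarrow> nat set" where
  "occupied_dirs k n D = {l. l < k \<and> (\<exists>i<n. D i = {l})}"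

text \<open>These bodyguards share the president's vertex.\<close>

definition captors :: "nat \<Rightarrow> (nat \<Rightarrow> nat set) \<Rightarrow> nat set" where
  "captors n D = {i. i < n \<and> D i = {}}"

text \<open>Rounding up lets a singleton grow to a pair at no cost, while removing two elements
  always lowers the weight.\<close>

definition half_weight :: "nat \<Rightarrow> (nat \<Rightarrow> nat set) \<Rightarrow> nat" where
  "half_weight n D = (\<Sum>i<n. (card (D i) + 1) div 2)"

definition all_even :: "nat \<Rightarrow> (nat \<Rightarrow> nat set) \<Rightarrow> bool" where
  "all_even n D \<longleftrightarrow> (\<forall>i<n. even (card (D i)))"

text \<open>This encodes the lexicographic order on the half weight, the parity flag and the number of
  uncovered directions.\<close>

definition chase_rank :: "nat \<Rightarrow> nat \<Rightarrow> (nat \<Rightarrow> nat set) \<Rightarrow> nat" where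
  "chase_rank k n D = 2 * (k + 1) * half_weight n D + (k + 1) * of_bool (all_even n D)
     + (k - card (\<Union>i<n. D i))"

text \<open>The spreading phase takes values up to \<open>k\<close>, the chase values above
  \<open>k\<close>, so entering the spreading phase always lowers the rank.\<close>

definition guard_rank :: "nat \<Rightarrow> nat \<Rightarrow> (nat \<Rightarrow> nat set) \<Rightarrow> nat" where
  "guard_rank k n D =
     (if k \<le> card (captors n D) + card (occupied_dirs k n D) then k - card (occupied_dirs k n D)
      else k + 1 + chase_rank k n D)"

text \<open>With \<open>S\<close> the difference set of a bodyguard before the president flips the coordinates in
  \<open>X\<close>, the bodyguard can reach difference set \<open>T\<close>.\<close>

definition reachable :: "nat set \<Rightarrow> nat set \<Rightarrow> nat set \<Rightarrow> bool" where
  "reachable X S T \<longleftrightarrow> card (sym_diff (sym_diff S X) T) \<le> 1"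

text \<open>The bodyguard copies the president's flip.\<close>

lemma reachable_same: "card X \<le> 1 \<Longrightarrow> reachable X S S"
proof -
  have "sym_diff (sym_diff S X) S = X" by auto
  then show "card X \<le> 1 \<Longrightarrow> reachable X S S" by (simp only: reachable_def)
qed

lemma reachableI:
  assumes "sym_diff (sym_diff S X) T \<subseteq> {a}"
  shows "reachable X S T"
  using card_mono[OF _ assms] by (simp add: reachable_def)

lemma president_move_cases:
  fixes X :: "nat set"
  assumes "X \<subseteq> {..<k}" "card X \<le> 1"
  obtains (stay) "X = {}" | (move) j where "X = {j}" "j < k"
proof -
  have "finite X" using assms(1) finite_subset by blast
  moreover have "card X = 0 \<or> card X = 1" using assms(2) by linarith
  ultimately consider "X = {}" | j where "X = {j}"
    by (auto simp: card_1_singleton_iff)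
  then show thesis using assms(1) that by cases auto
qed

lemma half_odd: "odd (Suc d) \<Longrightarrow> (d + 1) div 2 < (Suc d + 1) div 2"
  by presburger

lemma half_even: "odd d \<Longrightarrow> (d + 1) div 2 = (Suc d + 1) div 2"
  by presburger

lemma half_weight_upd:
  assumes "i < n"
  shows "half_weight n (D(i := S)) + (card (D i) + 1) div 2 = half_weight n D + (card S + 1) div 2"
proof -
  have "(\<Sum>m\<in>{..<n} - {i}. (card ((D(i := S)) m) + 1) div 2) =
      (\<Sum>m\<in>{..<n} - {i}. (card (D m) + 1) div 2)"
    by (rule sum.cong) auto
  then show ?thesis
    using assms by (simp add: half_weight_def sum.remove[of "{..<n}" i])
qed

text \<open>The two lower-order terms sum to at most \<open>2 * k + 1\<close>, less than one unit of
  half weight.\<close>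

lemma chase_rank_less_weight:
  assumes "half_weight n D' < half_weight n D"
  shows "chase_rank k n D' < chase_rank k n D"
proof -
  have "chase_rank k n D' \<le> 2 * (k + 1) * half_weight n D' + (k + 1) + k"
    unfolding chase_rank_def by (intro add_mono) auto
  also have "\<dots> < 2 * (k + 1) * (half_weight n D' + 1)"
    by simp
  also have "\<dots> \<le> 2 * (k + 1) * half_weight n D"
    using assms by (intro mult_left_mono) auto
  also have "\<dots> \<le> chase_rank k n D"
    by (simp add: chase_rank_def)
  finally show ?thesis .
qed

text \<open>The flag is worth \<open>k + 1\<close>, while the uncovered directions can add at most
  \<open>k\<close>.\<close>

lemma chase_rank_less_parity:
  assumes "half_weight n D' = half_weight n D" "all_even n D" "\<not> all_even n D'"
  shows "chase_rank k n D' < chase_rank k n D"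
  using assms by (simp add: chase_rank_def)

text \<open>The bound by \<open>{..<k}\<close> makes the truncated subtraction strictly decreasing
  in the covered set.\<close>

lemma chase_rank_less_cover:
  assumes "half_weight n D' = half_weight n D" "all_even n D' \<longrightarrow> all_even n D"
    and sub: "(\<Union>i<n. D i) \<subset> (\<Union>i<n. D' i)" and k: "(\<Union>i<n. D' i) \<subseteq> {..<k}"
  shows "chase_rank k n D' < chase_rank k n D"
proof -
  have fin: "finite (\<Union>i<n. D' i)"
    using k finite_subset by blast
  have "card (\<Union>i<n. D i) < card (\<Union>i<n. D' i)"
    using fin sub by (rule psubset_card_mono)
  moreover have "card (\<Union>i<n. D' i) \<le> k"
    using card_mono[OF _ k] by simp
  ultimately have "k - card (\<Union>i<n. D' i) < k - card (\<Union>i<n. D i)"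
    by linarith
  then show ?thesis
    using assms(1,2) by (auto simp: chase_rank_def of_bool_def)
qed

section \<open>Chasing the president\<close>

text \<open>With at most one singleton, the at least \<open>k div 2 + 1\<close> nonempty disjoint
  sets would have \<open>1 + 2 * (k div 2) >= k\<close> elements in total, yet they miss a
  coordinate.\<close>

lemma two_singletons:
  assumes sub: "\<And>i. i < n \<Longrightarrow> D i \<subseteq> {..<k}" and n: "n \<ge> k + k div 2"
    and few: "card (captors n D) < k"
    and disj: "\<And>i i'. i < n \<Longrightarrow> i' < n \<Longrightarrow> i \<noteq> i' \<Longrightarrow> D i \<inter> D i' = {}"
    and miss: "(\<Union>i<n. D i) \<noteq> {..<k}"
  shows "\<exists>i i'. i < n \<and> i' < n \<and> i \<noteq> i' \<and> card (D i) = 1 \<and> card (D i') = 1"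
proof (rule ccontr)
  assume no: "\<not> ?thesis"
  have fin: "finite (D i)" if "i < n" for i
    using sub[OF that] finite_subset by blast
  define A where "A = {..<n} - captors n D"
  have fA: "finite A" by (simp add: A_def)
  have "captors n D \<subseteq> {..<n}"
    by (auto simp: captors_def)
  then have "card A = n - card (captors n D)"
    unfolding A_def by (subst card_Diff_subset) (auto intro: finite_subset)
  then have cardA: "card A \<ge> k div 2 + 1"
    using n few by linarith
  have A: "i < n" "card (D i) \<ge> 1" if "i \<in> A" for i
    using that fin[of i] by (auto simp: A_def captors_def Suc_le_eq card_gt_0_iff)
  \<comment> \<open>The only singleton if there is one, otherwise any index in
    \<open>A\<close>.\<close>
  obtain i0 where i0: "i0 \<in> A" "\<And>i. i \<in> A - {i0} \<Longrightarrow> card (D i) \<ge> 2"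
  proof (cases "\<exists>i\<in>A. card (D i) = 1")
    case True
    then obtain i0 where i0: "i0 \<in> A" "card (D i0) = 1" by blast
    have "card (D i) \<ge> 2" if "i \<in> A - {i0}" for i
      using no i0 A[of i0] A[of i] that by force
    then show ?thesis using that i0 by blast
  next
    case False
    moreover obtain i0 where "i0 \<in> A" using cardA by fastforce
    ultimately show ?thesis using that[of i0] A by force
  qed
  have "k \<le> 1 + 2 * (card A - 1)"
    using cardA by linarith
  also have "\<dots> \<le> card (D i0) + (\<Sum>i\<in>A - {i0}. card (D i))"
    using A(2)[OF i0(1)] sum_bounded_below[of "A - {i0}" 2 "\<lambda>i. card (D i)"] i0 fA
    by (simp add: mult.commute)
  also have "\<dots> = (\<Sum>i\<in>A. card (D i))"
    using sum.remove[OF fA i0(1), of "\<lambda>i. card (D i)"] by simp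
  also have "\<dots> \<le> (\<Sum>i<n. card (D i))"
    by (rule sum_mono2) (auto simp: A_def)
  also have "\<dots> = card (\<Union>i<n. D i)"
    using fin disj by (subst card_UN_disjoint) auto
  also have "\<dots> < card {..<k}"
    using sub miss by (intro psubset_card_mono) auto
  finally show False by simp
qed

lemma chase_step:
  assumes sub: "\<And>i. i < n \<Longrightarrow> D i \<subseteq> {..<k}" and n: "n \<ge> k + k div 2"
    and few: "card (captors n D) < k"
    and X: "X \<subseteq> {..<k}" "card X \<le> 1"
  shows "\<exists>i<n. \<exists>S\<subseteq>{..<k}. reachable X (D i) S \<and> chase_rank k n (D(i := S)) < chase_rank k n D"
proof -
  have fin: "finite (D i)" if "i < n" for i
    using sub[OF that] finite_subset by blast
  from X show ?thesis
  proof (cases rule: president_move_cases)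
    case stay
    have shrink: "D i - {a} \<subseteq> {..<k}" "reachable X (D i) (D i - {a})" if "i < n" for i a
      using sub[OF that] stay by (auto intro!: reachableI[where a = a])
    show ?thesis
    proof (cases "all_even n D")
      case False
      then obtain i where i: "i < n" "odd (card (D i))"
        by (auto simp: all_even_def)
      then obtain a where a: "a \<in> D i" by fastforce
      have "card (D i) = Suc (card (D i - {a}))"
        by (rule card.remove[OF fin[OF i(1)] a])
      then have "half_weight n (D(i := D i - {a})) < half_weight n D"
        using half_weight_upd[OF i(1), of D "D i - {a}"] i(2)
          half_odd[of "card (D i - {a})"] by simp
      then show ?thesis
        using i shrink chase_rank_less_weight
        by (intro exI[of _ i] conjI exI[of _ "D i - {a}"]) auto
    next
      case True
      have "captors n D \<noteq> {..<n}"
        using few n by (metis add_leD1 card_lessThan leD)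
      then obtain i where i: "i < n" "D i \<noteq> {}"
        by (auto simp: captors_def)
      then obtain a where a: "a \<in> D i" by blast
      have c: "card (D i) = Suc (card (D i - {a}))"
        by (rule card.remove[OF fin[OF i(1)] a])
      have odd: "odd (card (D i - {a}))"
        using True i(1) c by (auto simp: all_even_def)
      \<comment> \<open>Removing one element from an even set leaves the weight alone, but makes a
        size odd and clears the flag.\<close>
      then have "half_weight n (D(i := D i - {a})) = half_weight n D"
        using half_weight_upd[OF i(1), of D "D i - {a}"] c
          half_even[of "card (D i - {a})"] by simp
      moreover have "\<not> all_even n (D(i := D i - {a}))"
        using i(1) odd by (auto simp: all_even_def)
      ultimately show ?thesis
        using i(1) shrink chase_rank_less_parity True
        by (intro exI[of _ i] conjI exI[of _ "D i - {a}"]) auto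
    qed
  next
    case (move j)
    show ?thesis
    proof (cases "j \<in> (\<Union>i<n. D i)")
      case True
      then obtain i where i: "i < n" "j \<in> D i" by blast
      \<comment> \<open>The president's own flip removes \<open>j\<close>, so the bodyguard's move
        is free to remove \<open>a\<close>. The default \<open>a = j\<close> means standing still
        when nothing else is left.\<close>
      define a where "a = (if D i = {j} then j else SOME a. a \<in> D i - {j})"
      have a: "a \<in> D i" "a = j \<longrightarrow> D i = {j}"
        using i(2) some_in_eq[of "D i - {j}"] by (auto simp: a_def split: if_splits)
      let ?S = "D i - {j, a}"
      have "(card ?S + 1) div 2 < (card (D i) + 1) div 2"
      proof (cases "a = j")
        case True
        then show ?thesis using a by simp
      next
        case False
        then have "card (D i) = Suc (Suc (card ?S))"
          using a i fin[OF i(1)] card_Diff_subset[of "{j, a}" "D i"] card_mono[of "D i" "{j, a}"]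
          by simp
        then show ?thesis by simp
      qed
      then have "half_weight n (D(i := ?S)) < half_weight n D"
        using half_weight_upd[OF i(1), of D ?S] by linarith
      moreover have "reachable X (D i) ?S"
        using i move(1) by (intro reachableI[where a = a]) auto
      moreover have "?S \<subseteq> {..<k}"
        using sub[OF i(1)] by blast
      ultimately show ?thesis
        using i(1) chase_rank_less_weight by (intro exI[of _ i] conjI exI[of _ ?S]) auto
    next
      case new: False
      show ?thesis
      proof (cases "\<exists>i i'. i < n \<and> i' < n \<and> i \<noteq> i' \<and> D i \<inter> D i' \<noteq> {}")
        case True
        then obtain i i' a where i: "i < n" "i' < n" "i \<noteq> i'" "a \<in> D i" "a \<in> D i'"
          by blast
        \<comment> \<open>The president's flip inserts \<open>j\<close> and the bodyguard removes
          \<open>a\<close>. Sizes are unchanged, and \<open>D i'\<close> still covers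
          \<open>a\<close>.\<close>
        let ?S = "insert j (D i - {a})"
        have jD: "j \<notin> D m" if "m < n" for m
          using new that by blast
        have card: "card ?S = card (D i)"
          using fin[OF i(1)] jD[OF i(1)] card.remove[OF fin[OF i(1)] i(4)] by simp
        have "half_weight n (D(i := ?S)) = half_weight n D"
          using half_weight_upd[OF i(1), of D ?S] card by simp
        moreover have "all_even n (D(i := ?S)) \<longrightarrow> all_even n D"
          using card by (auto simp: all_even_def)
        moreover have "(\<Union>m<n. D m) \<subset> (\<Union>m<n. (D(i := ?S)) m)"
        proof
          show "(\<Union>m<n. D m) \<subseteq> (\<Union>m<n. (D(i := ?S)) m)"
          proof
            fix x assume "x \<in> (\<Union>m<n. D m)"
            then obtain m where m: "m < n" "x \<in> D m" by blast
            have "x \<in> (D(i := ?S)) (if m = i \<and> x = a then i' else m)"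
              using m i by auto
            then show "x \<in> (\<Union>m<n. (D(i := ?S)) m)"
              using m i by (auto split: if_splits)
          qed
          have "j \<in> (\<Union>m<n. (D(i := ?S)) m)"
            using i(1) by auto
          then show "(\<Union>m<n. D m) \<noteq> (\<Union>m<n. (D(i := ?S)) m)"
            using new by blast
        qed
        moreover have S: "?S \<subseteq> {..<k}"
          using sub[OF i(1)] move(2) by blast
        then have "(\<Union>m<n. (D(i := ?S)) m) \<subseteq> {..<k}"
          using sub by (intro UN_least) simp
        ultimately have "chase_rank k n (D(i := ?S)) < chase_rank k n D"
          by (rule chase_rank_less_cover)
        moreover have "reachable X (D i) ?S"
          using i move(1) jD[OF i(1)] by (intro reachableI[where a = a]) auto
        ultimately show ?thesis
          using i(1) S by (intro exI[of _ i] conjI exI[of _ ?S])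
      next
        case False
        moreover have "(\<Union>i<n. D i) \<noteq> {..<k}"
          using new move(2) by blast
        ultimately obtain i i' where i: "i < n" "i' < n" "i \<noteq> i'" "card (D i) = 1" "card (D i') = 1"
          using two_singletons[OF sub n few] by blast
        \<comment> \<open>The bodyguard stands still and the president's flip enlarges its
          singleton.\<close>
        let ?S = "insert j (D i)"
        have card: "card ?S = 2"
          using new i fin[OF i(1)] by simp
        have "half_weight n (D(i := ?S)) = half_weight n D"
          using half_weight_upd[OF i(1), of D ?S] card i(4) by simp
        \<comment> \<open>The second singleton keeps an odd size present, so the flag does not
          become true.\<close>
        moreover have "odd (card ((D(i := ?S)) i'))"
          using i(3,5) by simp
        then have "all_even n (D(i := ?S)) \<longrightarrow> all_even n D"
          using i(2) unfolding all_even_def by blast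
        moreover have "(\<Union>m<n. D m) \<subset> (\<Union>m<n. (D(i := ?S)) m)"
        proof
          show "(\<Union>m<n. D m) \<subseteq> (\<Union>m<n. (D(i := ?S)) m)"
            by (intro UN_mono) auto
          have "j \<in> (\<Union>m<n. (D(i := ?S)) m)"
            using i(1) by auto
          then show "(\<Union>m<n. D m) \<noteq> (\<Union>m<n. (D(i := ?S)) m)"
            using new by blast
        qed
        moreover have S: "?S \<subseteq> {..<k}"
          using sub[OF i(1)] move(2) by blast
        then have "(\<Union>m<n. (D(i := ?S)) m) \<subseteq> {..<k}"
          using sub by (intro UN_least) simp
        ultimately have "chase_rank k n (D(i := ?S)) < chase_rank k n D"
          by (rule chase_rank_less_cover)
        moreover have "reachable X (D i) ?S"
          using new i(1) move(1) by (intro reachableI[where a = j]) auto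
        ultimately show ?thesis
          using i(1) S by (intro exI[of _ i] conjI exI[of _ ?S])
      qed
    qed
  qed
qed

section \<open>Spreading over the neighbours\<close>

lemma occupied_dirs_upd:
  assumes "z < n" "D z = {}" "l < k"
  shows "insert l (occupied_dirs k n D) \<subseteq> occupied_dirs k n (D(z := {l}))"
proof
  fix x assume x: "x \<in> insert l (occupied_dirs k n D)"
  then consider "x = l" | i where "i < n" "D i = {x}"
    by (auto simp: occupied_dirs_def)
  then have "\<exists>i<n. (D(z := {l})) i = {x}"
  proof cases
    case 1
    then show ?thesis using assms(1) by (intro exI[of _ z]) simp
  next
    case 2
    then show ?thesis using assms(2) by (intro exI[of _ i]) auto
  qed
  moreover have "x < k" using x assms(3) by (auto simp: occupied_dirs_def)
  ultimately show "x \<in> occupied_dirs k n (D(z := {l}))"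
    by (simp add: occupied_dirs_def)
qed

text \<open>Each round spends at most one captor and gains at least one direction, so the sum of the
  two counts stays at least \<open>k\<close>.\<close>

lemma spread_step:
  assumes sub: "\<And>i. i < n \<Longrightarrow> D i \<subseteq> {..<k}"
    and near: "k \<le> card (captors n D) + card (occupied_dirs k n D)"
    and less: "card (occupied_dirs k n D) < k"
    and X: "X \<subseteq> {..<k}" "card X \<le> 1"
  shows "\<exists>D'. (\<forall>i<n. D' i \<subseteq> {..<k} \<and> reachable X (D i) (D' i)) \<and>
    k \<le> card (captors n D') + card (occupied_dirs k n D') \<and>
    card (occupied_dirs k n D) < card (occupied_dirs k n D')"
proof -
  let ?L = "occupied_dirs k n D" and ?Z = "captors n D"
  have Lk: "?L \<subseteq> {..<k}" by (auto simp: occupied_dirs_def)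
  have "?Z \<noteq> {}" using near less by auto
  then obtain z where z: "z < n" "D z = {}"
    by (auto simp: captors_def)
  have finish: ?thesis
    if D': "\<And>i. i < n \<Longrightarrow> D' i \<subseteq> {..<k} \<and> reachable X (D i) (D' i)"
      and Z: "?Z - {z} \<subseteq> captors n D'" and L: "insert l ?L \<subseteq> occupied_dirs k n D'" "l \<notin> ?L"
    for D' l
  proof -
    have fin: "finite (captors n D')" "finite (occupied_dirs k n D')" "finite ?L" "finite ?Z"
      by (simp_all add: captors_def occupied_dirs_def)
    have "z \<in> ?Z" using z by (simp add: captors_def)
    then have "card ?Z - 1 \<le> card (captors n D')"
      using card_mono[OF fin(1) Z] by simp
    moreover have "card ?L + 1 \<le> card (occupied_dirs k n D')"
      using card_mono[OF fin(2) L(1)] L(2) fin(3) by simp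
    ultimately show ?thesis
      using D' near by (intro exI[of _ D']) auto
  qed
  obtain l0 where l0: "l0 < k" "l0 \<notin> ?L"
  proof -
    have "?L \<noteq> {..<k}" using less by (metis card_lessThan less_irrefl)
    then show ?thesis using Lk that by blast
  qed
  from X show ?thesis
  proof (cases rule: president_move_cases)
    case stay
    have "reachable X {} {l0}"
      using stay by (intro reachableI[where a = l0]) auto
    moreover have "insert l0 ?L \<subseteq> occupied_dirs k n (D(z := {l0}))"
      using z l0(1) by (rule occupied_dirs_upd)
    ultimately show ?thesis
      using sub z l0 reachable_same[OF X(2)]
      by (intro finish[of "D(z := {l0})" l0]) (auto simp: captors_def)
  next
    case (move j)
    \<comment> \<open>A captor that stands still is left behind as the neighbour in direction
      \<open>j\<close>.\<close>
    have reach: "reachable X {} {j}"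
      using move by (intro reachableI[where a = j]) auto
    show ?thesis
    proof (cases "j \<in> ?L")
      case False
      have "insert j ?L \<subseteq> occupied_dirs k n (D(z := {j}))"
        using z move(2) by (rule occupied_dirs_upd)
      then show ?thesis
        using sub z move False reach reachable_same[OF X(2)]
        by (intro finish[of "D(z := {j})" j]) (auto simp: captors_def)
    next
      case True
      then obtain r where r: "r < n" "D r = {j}"
        by (auto simp: occupied_dirs_def)
      \<comment> \<open>The president steps onto the vertex of \<open>r\<close>. The captor
        \<open>z\<close>, standing still, takes over direction \<open>j\<close>, and
        \<open>r\<close> moves on to the free direction \<open>l0\<close>.\<close>
      let ?D = "D(z := {j}, r := {l0})"
      have zr: "z \<noteq> r" using z r by auto
      have "reachable X {j} {l0}"
        using move by (intro reachableI[where a = l0]) auto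
      moreover have "insert l0 ?L \<subseteq> occupied_dirs k n ?D"
      proof
        fix x assume x: "x \<in> insert l0 ?L"
        then consider "x = l0" | "x = j" | i where "i < n" "D i = {x}" "x \<noteq> l0" "x \<noteq> j"
          by (auto simp: occupied_dirs_def)
        then have "\<exists>i<n. ?D i = {x}"
        proof cases
          case 1
          then show ?thesis using r by (intro exI[of _ r]) auto
        next
          case 2
          then show ?thesis using z zr by (intro exI[of _ z]) auto
        next
          case 3
          then show ?thesis using z r by (intro exI[of _ i]) auto
        qed
        then show "x \<in> occupied_dirs k n ?D"
          using x l0(1) Lk by (auto simp: occupied_dirs_def)
      qed
      moreover have "?Z - {z} \<subseteq> captors n ?D"
        using r by (auto simp: captors_def)
      ultimately show ?thesis
        using sub z r move l0 reach reachable_same[OF X(2)]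
        by (intro finish[of ?D l0]) auto
    qed
  qed
qed

section \<open>Combining the two phases into a strategy\<close>

lemma guard_rank_step:
  assumes sub: "\<And>i. i < n \<Longrightarrow> D i \<subseteq> {..<k}" and n: "n \<ge> k + k div 2"
    and X: "X \<subseteq> {..<k}" "card X \<le> 1"
  shows "\<exists>D'. (\<forall>i<n. D' i \<subseteq> {..<k} \<and> reachable X (D i) (D' i)) \<and>
    (guard_rank k n D' < guard_rank k n D \<or> guard_rank k n D' = 0)"
proof (cases "k \<le> card (captors n D) + card (occupied_dirs k n D)")
  case near: True
  show ?thesis
  proof (cases "card (occupied_dirs k n D) < k")
    case True
    show ?thesis
    proof -
      obtain D' where D': "\<forall>i<n. D' i \<subseteq> {..<k} \<and> reachable X (D i) (D' i)"
        and "k \<le> card (captors n D') + card (occupied_dirs k n D')"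
        and "card (occupied_dirs k n D) < card (occupied_dirs k n D')"
        using spread_step[OF sub near True X] by blast
      then have "guard_rank k n D' < guard_rank k n D"
        using near True by (simp add: guard_rank_def)
      with D' show ?thesis by blast
    qed
  next
    \<comment> \<open>All directions are occupied, so copying the president's move keeps the rank at
      0.\<close>
    case False
    then show ?thesis
      using near sub reachable_same[OF X(2)] by (intro exI[of _ D]) (auto simp: guard_rank_def)
  qed
next
  case far: False
  then obtain i S where i: "i < n" "S \<subseteq> {..<k}" "reachable X (D i) S"
      "chase_rank k n (D(i := S)) < chase_rank k n D"
    using chase_step[OF sub n _ X] by fastforce
  then have "guard_rank k n (D(i := S)) < guard_rank k n D"
    using far by (auto simp: guard_rank_def)
  then show ?thesis
    using i sub reachable_same[OF X(2)] by (intro exI[of _ "D(i := S)"]) auto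
qed

lemma cube_bodyguards_win:
  "bodyguards_win (cube_verts k) (cube_adj k) (k + k div 2)"
proof -
  let ?n = "k + k div 2"
  interpret finite_simple_graph "cube_verts k" "cube_adj k"
    by (rule finite_simple_graph_cube)
  define rank where "rank bs x = guard_rank k ?n (\<lambda>i. cube_diff k (bs ! i) x)" for bs x
  \<comment> \<open>Needed because \<open>D'\<close> and the sets read off \<open>cs\<close> are
    known to agree only below \<open>?n\<close>.\<close>
  have rank_cong: "guard_rank k ?n D = guard_rank k ?n D'" if "\<And>i. i < ?n \<Longrightarrow> D i = D' i" for D D'
  proof -
    have "captors ?n D = captors ?n D'" "occupied_dirs k ?n D = occupied_dirs k ?n D'"
      "half_weight ?n D = half_weight ?n D'" "all_even ?n D = all_even ?n D'"
      "(\<Union>i<?n. D i) = (\<Union>i<?n. D' i)"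
      using that
      by (auto simp: captors_def occupied_dirs_def half_weight_def all_even_def intro!: sum.cong)
    then show ?thesis by (simp only: guard_rank_def chase_rank_def)
  qed
  obtain v where v: "v \<in> cube_verts k"
    unfolding cube_verts_def by (metis PiE_eq_empty_iff ex_in_conv insert_not_empty)
  show ?thesis
  proof (rule bodyguards_win_by_rank[of "replicate ?n v" _ rank])
    show "length (replicate ?n v) = ?n" by simp
    show "set (replicate ?n v) \<subseteq> cube_verts k" using v by auto
  next
    fix bs x y
    assume len: "length bs = ?n" and bs: "set bs \<subseteq> cube_verts k" and x: "x \<in> cube_verts k"
      and xy: "token_move (cube_adj k) x y"
    have y: "y \<in> cube_verts k" using token_move_in_verts[OF xy x] .
    have bV: "bs ! i \<in> cube_verts k" if "i < ?n" for i
      using that len bs nth_mem by (metis subsetD)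
    let ?D = "\<lambda>i. cube_diff k (bs ! i) x"
    obtain D' where D': "\<And>i. i < ?n \<Longrightarrow> D' i \<subseteq> {..<k}"
        "\<And>i. i < ?n \<Longrightarrow> reachable (cube_diff k x y) (?D i) (D' i)"
      and less: "guard_rank k ?n D' < guard_rank k ?n ?D \<or> guard_rank k ?n D' = 0"
      using guard_rank_step[of ?n ?D k "cube_diff k x y"] cube_diff_subset xy
      unfolding cube_token_move_iff[OF x y] by (metis order_refl)
    define cs where "cs = map (\<lambda>i. cube_flip k (D' i) y) [0..<?n]"
    have diff: "cube_diff k (cs ! i) y = D' i" if "i < ?n" for i
      using that D'(1) y by (simp add: cs_def cube_diff_flip)
    have "token_move (cube_adj k) (bs ! i) (cs ! i)" if "i < ?n" for i
    proof -
      have cV: "cs ! i \<in> cube_verts k" using that y by (simp add: cs_def)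
      \<comment> \<open>Splitting the bodyguard's move at \<open>y\<close>, then at
        \<open>x\<close>, turns it into the form of \<open>reachable\<close>.\<close>
      have "cube_diff k (bs ! i) (cs ! i) = sym_diff (cube_diff k (bs ! i) y) (cube_diff k y (cs ! i))"
        by (rule cube_diff_triangle[OF bV[OF that] y cV])
      also have "\<dots> = sym_diff (sym_diff (?D i) (cube_diff k x y)) (D' i)"
        by (simp only: cube_diff_triangle[OF bV[OF that] x y] diff[OF that]
            cube_diff_commute[of k y "cs ! i"])
      finally show ?thesis
        using D'(2)[OF that] bV[OF that] cV by (simp add: cube_token_move_iff reachable_def)
    qed
    then have "list_all2 (token_move (cube_adj k)) bs cs"
      using len by (auto simp: list_all2_conv_all_nth cs_def)
    moreover have "rank cs y = guard_rank k ?n D'"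
      unfolding rank_def using diff by (rule rank_cong)
    ultimately show "\<exists>cs. list_all2 (token_move (cube_adj k)) bs cs \<and>
        (rank cs y < rank bs x \<or> rank cs y = 0)"
      using less by (auto simp: rank_def)
  next
    fix bs x
    assume len: "length bs = ?n" and bs: "set bs \<subseteq> cube_verts k" and x: "x \<in> cube_verts k"
      and "rank bs x = 0"
    let ?L = "occupied_dirs k ?n (\<lambda>i. cube_diff k (bs ! i) x)"
    have "k \<le> card ?L"
      using \<open>rank bs x = 0\<close> by (auto simp: rank_def guard_rank_def split: if_splits)
    moreover have "?L \<subseteq> {..<k}" by (auto simp: occupied_dirs_def)
    ultimately have L: "?L = {..<k}"
      by (intro card_seteq) auto
    show "surrounded (cube_adj k) bs x"
      unfolding surrounded_def
    proof (intro allI impI)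
      fix w assume "cube_adj k x w"
      then have w: "w \<in> cube_verts k" "card (cube_diff k x w) = 1"
        by (auto simp: cube_adj_iff)
      then obtain l where l: "cube_diff k x w = {l}"
        by (auto simp: card_1_singleton_iff)
      then have "l \<in> ?L" using cube_diff_subset[of k x w] L by auto
      then obtain i where i: "i < ?n" "cube_diff k (bs ! i) x = {l}"
        by (auto simp: occupied_dirs_def)
      have bV: "bs ! i \<in> cube_verts k"
        using i(1) len bs nth_mem by (metis subsetD)
      \<comment> \<open>Both vertices differ from \<open>x\<close> in exactly the coordinate
        \<open>l\<close>.\<close>
      have "cube_diff k (bs ! i) w = {}"
        using cube_diff_triangle[OF bV x w(1)] i(2) l by simp
      then have "bs ! i = w"
        using cube_diff_empty_iff[OF bV w(1)] by simp
      then show "w \<in> set bs" using i(1) len nth_mem by metis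
    qed
  qed
qed

theorem theorem4p8:
  fixes k :: nat
  assumes "k \<ge> 3"
  shows "k + 1 \<le> bodyguard_number (cube_verts k) (cube_adj k)
    \<and> bodyguard_number (cube_verts k) (cube_adj k) \<le> (3 * k) div 2"
proof
  interpret finite_simple_graph "cube_verts k" "cube_adj k"
    by (rule finite_simple_graph_cube)
  have "\<not> bodyguard_number (cube_verts k) (cube_adj k) \<le> k"
    using cube_not_bodyguards_win[OF assms] bodyguards_win_bodyguard_number by blast
  then show "k + 1 \<le> bodyguard_number (cube_verts k) (cube_adj k)"
    by simp
  have "bodyguard_number (cube_verts k) (cube_adj k) \<le> k + k div 2"
    unfolding bodyguard_number_def by (rule Least_le) (rule cube_bodyguards_win)
  then show "bodyguard_number (cube_verts k) (cube_adj k) \<le> (3 * k) div 2"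
    by simp
qed

end
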